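(* Let $\mathcal Q$ be any set of generalized quantifiers of type $(1)$ (no monotonicity assumed), let $\varphi$ be a formula of $DF(\mathcal Q)$, and let $X$ be a team on a structure $M$ suitable for $\varphi$. Then $$M,X\models\varphi\iff M,X_{\upharpoonright FV(\varphi)}\models\varphi.$$
   Context: A generalized quantifier of type $(1)$ is a class $Q$ of structures $(M,S)$ with $S$ unary; its local version is $Q^M=\{S\subseteq M:(M,S)\in Q\}\subseteq\wp(M)$. Assignments are functions from a finite set of variables to $M$; $s(a/v)$ sends $v$ to $a$ and agrees with $s$ elsewhere. A team $X$ is a set of assignments with common domain $dom(X)$; for $U\subseteq dom(X)$, $X_{\upharpoonright U}=\{s_{\upharpoonright U}: s\in X\}$. $s\sim_W s'$ means $s(x)=s'(x)$ for all $x\in dom(s)\setminus W$; $F:X\to\wp(M)$ is $W$-uniform if $s\sim_W s'$ implies $F(s)=F(s')$. $X[F/v]=\{s(a/v):s\in X,a\in F(s)\}$, $X[M/v]=\{s(a/v):s\in X,a\in M\}$. Formulas of $DF(\mathcal Q)$: atomic $\alpha$, $\neg\alpha$ ($\alpha$ atomic), $\psi\land\chi$, $\psi\lor\chi$, $(\exists v\backslash V)\psi$, $(\forall v\backslash V)\psi$, $(Qv\backslash V)\psi$ for $Q\in\mathcal Q$, $V$ a finite set of variables. Free variables: $FV(\alpha)=FV(\neg\alpha)$ = variables of $\alpha$; $FV(\psi\land\chi)=FV(\psi\lor\chi)=FV(\psi)\cup FV(\chi)$; $FV((\mathsf Qv\backslash V)\psi)=(FV(\psi)\setminus\{v\})\cup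 V$. $X$ is suitable for $\varphi$ if $dom(X)\supseteq FV(\varphi)$. Semantics: $M,X\models\alpha$ (resp. $\neg\alpha$) iff every $s\in X$ satisfies it in the Tarskian sense; $\land$ componentwise; $M,X\models\psi\lor\chi$ iff $X=Y\cup Z$ with $M,Y\models\psi$, $M,Z\models\chi$; $M,X\models(\forall v\backslash V)\psi$ iff $M,X[M/v]\models\psi$; $M,X\models(\exists v\backslash V)\psi$ iff $M,X[F/v]\models\psi$ for some $(dom(X)\setminus V)$-uniform $F:X\to\wp(M)\setminus\{\emptyset\}$; $M,X\models(Qv\backslash V)\psi$ iff $M,X[F/v]\models\psi$ for some $(dom(X)\setminus V)$-uniform $F:X\to Q^M$. *)

theory Defs
  imports Main "HOL-Library.FuncSet"
begin

section \<open>Vocabularies, structures and generalized quantifiers\<close>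

text \<open>
  A symbol belongs to the vocabulary iff it is assigned an arity; constants are function symbols of
  arity 0.
\<close>

record ('f, 'r) vocab =
  fun_arity :: "'f \<Rightarrow> nat option"
  rel_arity :: "'r \<Rightarrow> nat option"

record ('f, 'r, 'm) struct =
  univ :: "'m set"
  fun_int :: "'f \<Rightarrow> 'm list \<Rightarrow> 'm"
  rel_int :: "'r \<Rightarrow> 'm list set"

definition is_structure :: "('f, 'r) vocab \<Rightarrow> ('f, 'r, 'm) struct \<Rightarrow> bool" where
  "is_structure L M \<longleftrightarrow>
     (\<forall>f as. fun_arity L f = Some (length as) \<and> set as \<subseteq> univ M \<longrightarrow> fun_int M f as \<in> univ M) \<and>
     (\<forall>r n. rel_arity L r = Some n \<longrightarrow> rel_int M r \<subseteq> {as. length as = n \<and> set as \<subseteq> univ M})"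

text \<open>
  A type (1) quantifier is a class of structures \<open>(M, S)\<close> with \<open>S \<subseteq> M\<close>. It enters the semantics
  over a structure only through its local version on that structure, so the class is represented by
  its members whose universe is a set of elements of the (arbitrary) type \<open>'m\<close>. Closure under
  isomorphism is not required.
\<close>

type_synonym 'm quantifier = "('m set \<times> 'm set) set"

definition generalized_quantifier :: "'m quantifier \<Rightarrow> bool" where
  "generalized_quantifier Q \<longleftrightarrow> (\<forall>(A, S) \<in> Q. S \<subseteq> A)"

definition local_quantifier :: "'m quantifier \<Rightarrow> 'm set \<Rightarrow> 'm set set" where
  "local_quantifier Q A = {S. S \<subseteq> A \<and> (A, S) \<in> Q}"

section \<open>Syntax\<close>

datatype ('f, 'v) trm = Var 'v | Fun 'f "('f, 'v) trm list"

datatype ('f, 'r, 'v) atom =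
    Eq "('f, 'v) trm" "('f, 'v) trm"
  | Rel 'r "('f, 'v) trm list"

text \<open>
  \<open>Exists v V \<psi>\<close>, \<open>Forall v V \<psi>\<close> and \<open>Quant Q v V \<psi>\<close> are the slashed quantifications
  of \<open>v\<close> with the set \<open>V\<close> after the backslash. The quantifier \<open>Q\<close> itself is used as its symbol.
\<close>

datatype ('f, 'r, 'v, 'm) fm =
    Atom "('f, 'r, 'v) atom"
  | NegAtom "('f, 'r, 'v) atom"
  | Conj "('f, 'r, 'v, 'm) fm" "('f, 'r, 'v, 'm) fm"
  | Disj "('f, 'r, 'v, 'm) fm" "('f, 'r, 'v, 'm) fm"
  | Exists 'v "'v set" "('f, 'r, 'v, 'm) fm"
  | Forall 'v "'v set" "('f, 'r, 'v, 'm) fm"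
  | Quant "'m quantifier" 'v "'v set" "('f, 'r, 'v, 'm) fm"

primrec wf_trm :: "('f, 'r) vocab \<Rightarrow> ('f, 'v) trm \<Rightarrow> bool" where
  "wf_trm L (Var x) \<longleftrightarrow> True"
| "wf_trm L (Fun f ts) \<longleftrightarrow> fun_arity L f = Some (length ts) \<and> list_all (wf_trm L) ts"

primrec wf_atom :: "('f, 'r) vocab \<Rightarrow> ('f, 'r, 'v) atom \<Rightarrow> bool" where
  "wf_atom L (Eq t u) \<longleftrightarrow> wf_trm L t \<and> wf_trm L u"
| "wf_atom L (Rel r ts) \<longleftrightarrow> rel_arity L r = Some (length ts) \<and> list_all (wf_trm L) ts"

primrec is_DF :: "('f, 'r) vocab \<Rightarrow> 'm quantifier set \<Rightarrow> ('f, 'r, 'v, 'm) fm \<Rightarrow> bool" where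
  "is_DF L \<Q> (Atom \<alpha>) \<longleftrightarrow> wf_atom L \<alpha>"
| "is_DF L \<Q> (NegAtom \<alpha>) \<longleftrightarrow> wf_atom L \<alpha>"
| "is_DF L \<Q> (Conj \<psi> \<chi>) \<longleftrightarrow> is_DF L \<Q> \<psi> \<and> is_DF L \<Q> \<chi>"
| "is_DF L \<Q> (Disj \<psi> \<chi>) \<longleftrightarrow> is_DF L \<Q> \<psi> \<and> is_DF L \<Q> \<chi>"
| "is_DF L \<Q> (Exists v V \<psi>) \<longleftrightarrow> finite V \<and> is_DF L \<Q> \<psi>"
| "is_DF L \<Q> (Forall v V \<psi>) \<longleftrightarrow> finite V \<and> is_DF L \<Q> \<psi>"
| "is_DF L \<Q> (Quant Q v V \<psi>) \<longleftrightarrow> Q \<in> \<Q> \<and> finite V \<and> is_DF L \<Q> \<psi>"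

definition DF :: "('f, 'r) vocab \<Rightarrow> 'm quantifier set \<Rightarrow> ('f, 'r, 'v, 'm) fm set" where
  "DF L \<Q> = {\<phi>. is_DF L \<Q> \<phi>}"

primrec vars_trm :: "('f, 'v) trm \<Rightarrow> 'v set" where
  "vars_trm (Var x) = {x}"
| "vars_trm (Fun f ts) = \<Union> (set (map vars_trm ts))"

primrec vars_atom :: "('f, 'r, 'v) atom \<Rightarrow> 'v set" where
  "vars_atom (Eq t u) = vars_trm t \<union> vars_trm u"
| "vars_atom (Rel r ts) = \<Union> (set (map vars_trm ts))"

primrec FV :: "('f, 'r, 'v, 'm) fm \<Rightarrow> 'v set" where
  "FV (Atom \<alpha>) = vars_atom \<alpha>"
| "FV (NegAtom \<alpha>) = vars_atom \<alpha>"
| "FV (Conj \<psi> \<chi>) = FV \<psi> \<union> FV \<chi>"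
| "FV (Disj \<psi> \<chi>) = FV \<psi> \<union> FV \<chi>"
| "FV (Exists v V \<psi>) = (FV \<psi> - {v}) \<union> V"
| "FV (Forall v V \<psi>) = (FV \<psi> - {v}) \<union> V"
| "FV (Quant Q v V \<psi>) = (FV \<psi> - {v}) \<union> V"

section \<open>Teams\<close>

text \<open>
  Assignments are finite partial maps. A team carries its domain explicitly, since the domain of
  the empty team cannot be recovered from its set of assignments.
\<close>

type_synonym ('v, 'm) asg = "'v \<rightharpoonup> 'm"

record ('v, 'm) team =
  tdom :: "'v set"
  asgs :: "('v, 'm) asg set"

definition is_team :: "'m set \<Rightarrow> ('v, 'm) team \<Rightarrow> bool" where
  "is_team A X \<longleftrightarrow> finite (tdom X) \<and> (\<forall>s \<in> asgs X. dom s = tdom X \<and> ran s \<subseteq> A)"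

definition suitable :: "('v, 'm) team \<Rightarrow> ('f, 'r, 'v, 'm) fm \<Rightarrow> bool" where
  "suitable X \<phi> \<longleftrightarrow> FV \<phi> \<subseteq> tdom X"

definition team_restrict :: "('v, 'm) team \<Rightarrow> 'v set \<Rightarrow> ('v, 'm) team" where
  "team_restrict X U = \<lparr>tdom = tdom X \<inter> U, asgs = (\<lambda>s. s |` U) ` asgs X\<rparr>"

definition asg_sim :: "'v set \<Rightarrow> ('v, 'm) asg \<Rightarrow> ('v, 'm) asg \<Rightarrow> bool" where
  "asg_sim W s s' \<longleftrightarrow> (\<forall>x \<in> dom s - W. s x = s' x)"

definition uniform :: "'v set \<Rightarrow> ('v, 'm) team \<Rightarrow> (('v, 'm) asg \<Rightarrow> 'm set) \<Rightarrow> bool" where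
  "uniform W X F \<longleftrightarrow> (\<forall>s \<in> asgs X. \<forall>s' \<in> asgs X. asg_sim W s s' \<longrightarrow> F s = F s')"

definition supplement ::
  "('v, 'm) team \<Rightarrow> (('v, 'm) asg \<Rightarrow> 'm set) \<Rightarrow> 'v \<Rightarrow> ('v, 'm) team" where
  "supplement X F v =
     \<lparr>tdom = insert v (tdom X), asgs = {s(v \<mapsto> a) | s a. s \<in> asgs X \<and> a \<in> F s}\<rparr>"

definition duplicate :: "('v, 'm) team \<Rightarrow> 'm set \<Rightarrow> 'v \<Rightarrow> ('v, 'm) team" where
  "duplicate X A v =
     \<lparr>tdom = insert v (tdom X), asgs = {s(v \<mapsto> a) | s a. s \<in> asgs X \<and> a \<in> A}\<rparr>"

section \<open>Semantics\<close>

primrec eval_trm :: "('f, 'r, 'm) struct \<Rightarrow> ('v, 'm) asg \<Rightarrow> ('f, 'v) trm \<Rightarrow> 'm" where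
  "eval_trm M s (Var x) = the (s x)"
| "eval_trm M s (Fun f ts) = fun_int M f (map (eval_trm M s) ts)"

primrec sat_atom :: "('f, 'r, 'm) struct \<Rightarrow> ('v, 'm) asg \<Rightarrow> ('f, 'r, 'v) atom \<Rightarrow> bool" where
  "sat_atom M s (Eq t u) \<longleftrightarrow> eval_trm M s t = eval_trm M s u"
| "sat_atom M s (Rel r ts) \<longleftrightarrow> map (eval_trm M s) ts \<in> rel_int M r"

fun sat :: "('f, 'r, 'm) struct \<Rightarrow> ('v, 'm) team \<Rightarrow> ('f, 'r, 'v, 'm) fm \<Rightarrow> bool" where
  "sat M X (Atom \<alpha>) \<longleftrightarrow> (\<forall>s \<in> asgs X. sat_atom M s \<alpha>)"
| "sat M X (NegAtom \<alpha>) \<longleftrightarrow> (\<forall>s \<in> asgs X. \<not> sat_atom M s \<alpha>)"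
| "sat M X (Conj \<psi> \<chi>) \<longleftrightarrow> sat M X \<psi> \<and> sat M X \<chi>"
| "sat M X (Disj \<psi> \<chi>) \<longleftrightarrow>
     (\<exists>Y Z. asgs X = Y \<union> Z \<and>
       sat M \<lparr>tdom = tdom X, asgs = Y\<rparr> \<psi> \<and> sat M \<lparr>tdom = tdom X, asgs = Z\<rparr> \<chi>)"
| "sat M X (Exists v V \<psi>) \<longleftrightarrow>
     (\<exists>F. F \<in> asgs X \<rightarrow> Pow (univ M) - {{}} \<and> uniform (tdom X - V) X F \<and>
       sat M (supplement X F v) \<psi>)"
| "sat M X (Forall v V \<psi>) \<longleftrightarrow> sat M (duplicate X (univ M) v) \<psi>"
| "sat M X (Quant Q v V \<psi>) \<longleftrightarrow>
     (\<exists>F. F \<in> asgs X \<rightarrow> local_quantifier Q (univ M) \<and> uniform (tdom X - V) X F \<and>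
       sat M (supplement X F v) \<psi>)"

end

(* Two teams with the same restriction to FV phi satisfy phi simultaneously; as a team and its
   restriction to FV phi are such a pair, a one-directional transfer, by induction on phi, suffices.
   For the quantifiers, a (dom X - V)-uniform choice function is one that depends only on the
   values on V, and V is contained in the free variables, so it can be read off the restricted
   assignments. *)

theory Submission
  imports Defs
begin

section \<open>Restricted assignments: atoms and uniformity\<close>

lemma restrict_map_eq_iff: "s |` U = t |` U \<longleftrightarrow> (\<forall>x \<in> U. s x = t x)"
  by (auto simp: restrict_map_def fun_eq_iff)

lemma eval_trm_cong:
  assumes "s |` U = t |` U" and "vars_trm u \<subseteq> U"
  shows "eval_trm M s u = eval_trm M t u"
  using assms(2)
proof (induction u)
  case (Var x)
  then show ?case using assms(1) by (simp add: restrict_map_eq_iff)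
next
  case (Fun f ts)
  then have "map (eval_trm M s) ts = map (eval_trm M t) ts"
    by (fastforce intro: map_cong)
  then show ?case by (metis eval_trm.simps(2))
qed

lemma sat_atom_cong:
  assumes "s |` U = t |` U" and "vars_atom \<alpha> \<subseteq> U"
  shows "sat_atom M s \<alpha> \<longleftrightarrow> sat_atom M t \<alpha>"
proof (cases \<alpha>)
  case (Eq u w)
  then show ?thesis
    using assms eval_trm_cong[OF assms(1), of u M] eval_trm_cong[OF assms(1), of w M] by simp
next
  case (Rel r ts)
  have "map (eval_trm M s) ts = map (eval_trm M t) ts"
    using assms(2) Rel by (intro map_cong refl eval_trm_cong[OF assms(1)]) auto
  then show ?thesis using Rel by (metis sat_atom.simps(2))
qed

text \<open>A double complement: agreement is demanded outside \<open>D - V\<close>, hence on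
  \<open>D - (D - V)\<close>, which is \<open>V\<close> because
  \<open>V \<subseteq> D\<close>.\<close>

lemma asg_sim_slashed_iff:
  assumes "dom s = D" and "V \<subseteq> D"
  shows "asg_sim (D - V) s s' \<longleftrightarrow> s |` V = s' |` V"
  using assms by (auto simp: asg_sim_def restrict_map_eq_iff)

lemma uniform_slashed_iff:
  assumes "\<forall>s \<in> asgs X. dom s = tdom X" and "V \<subseteq> tdom X"
  shows "uniform (tdom X - V) X F \<longleftrightarrow>
    (\<forall>s \<in> asgs X. \<forall>s' \<in> asgs X. s |` V = s' |` V \<longrightarrow> F s = F s')"
  using assms by (simp add: uniform_def asg_sim_slashed_iff)

section \<open>Teams with equal restrictions, as a back-and-forth matching of assignments\<close>

lemma team_restrict_eqD:
  assumes "team_restrict X U = team_restrict Y U" and "s \<in> asgs X"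
  obtains t where "t \<in> asgs Y" and "t |` U = s |` U"
proof -
  have "s |` U \<in> (\<lambda>t. t |` U) ` asgs Y"
    using assms by (auto simp: team_restrict_def)
  then show ?thesis using that by (metis imageE)
qed

lemma team_restrict_eqI:
  assumes "tdom X \<inter> U = tdom Y \<inter> U"
    and "\<And>s. s \<in> asgs X \<Longrightarrow> \<exists>t \<in> asgs Y. t |` U = s |` U"
    and "\<And>t. t \<in> asgs Y \<Longrightarrow> \<exists>s \<in> asgs X. s |` U = t |` U"
  shows "team_restrict X U = team_restrict Y U"
proof -
  have "(\<lambda>s. s |` U) ` asgs X = (\<lambda>s. s |` U) ` asgs Y"
  proof (intro equalityI image_subsetI)
    fix s assume "s \<in> asgs X"
    then show "s |` U \<in> (\<lambda>t. t |` U) ` asgs Y" using assms(2) by (metis image_eqI)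
  next
    fix t assume "t \<in> asgs Y"
    then show "t |` U \<in> (\<lambda>s. s |` U) ` asgs X" using assms(3) by (metis image_eqI)
  qed
  then show ?thesis using assms(1) by (simp add: team_restrict_def)
qed

text \<open>Partners that agree on \<open>U\<close> agree on \<open>W\<close>. This is the descent
  from the free variables of a conjunction or disjunction to those of one component.\<close>

lemma team_restrict_eq_mono:
  assumes "team_restrict X U = team_restrict Y U" and "W \<subseteq> U"
  shows "team_restrict X W = team_restrict Y W"
proof (rule team_restrict_eqI)
  show "tdom X \<inter> W = tdom Y \<inter> W"
    using assms by (auto simp: team_restrict_def)
next
  fix s assume "s \<in> asgs X"
  then obtain t where "t \<in> asgs Y" "t |` U = s |` U"
    using team_restrict_eqD[OF assms(1)] by blast
  then show "\<exists>t \<in> asgs Y. t |` W = s |` W"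
    using assms(2) by (auto simp: restrict_map_eq_iff)
next
  fix t assume "t \<in> asgs Y"
  then obtain s where "s \<in> asgs X" "s |` U = t |` U"
    using team_restrict_eqD[OF assms(1)[symmetric]] by blast
  then show "\<exists>s \<in> asgs X. s |` W = t |` W"
    using assms(2) by (auto simp: restrict_map_eq_iff)
qed

lemma team_restrict_eq_tdom:
  assumes "team_restrict X U = team_restrict Y U" and "U \<subseteq> tdom X"
  shows "U \<subseteq> tdom Y"
  using assms by (auto simp: team_restrict_def)

section \<open>Transfer of supplementations, splittings and satisfaction\<close>

lemma asgs_supplement:
  "r \<in> asgs (supplement X F v) \<longleftrightarrow> (\<exists>s a. r = s(v \<mapsto> a) \<and> s \<in> asgs X \<and> a \<in> F s)"
  by (auto simp: supplement_def)

lemma tdom_supplement [simp]: "tdom (supplement X F v) = insert v (tdom X)"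
  by (simp add: supplement_def)

lemma dom_supplement:
  assumes "\<forall>s \<in> asgs X. dom s = tdom X"
  shows "\<forall>s \<in> asgs (supplement X F v). dom s = tdom (supplement X F v)"
proof
  fix r assume "r \<in> asgs (supplement X F v)"
  then obtain s a where "r = s(v \<mapsto> a)" "s \<in> asgs X"
    by (auto simp: asgs_supplement)
  then show "dom r = tdom (supplement X F v)" using assms by simp
qed

text \<open>Lets the universal quantifier share the lemmas on supplementation, with a constant
  choice function.\<close>

lemma duplicate_eq_supplement: "duplicate X A v = supplement X (\<lambda>_. A) v"
  by (simp add: duplicate_def supplement_def)

text \<open>Partners over \<open>U\<close> may differ at \<open>v\<close>, but the update overwrites
  that value with the same \<open>a\<close>, available on both sides by \<open>FG\<close>; the rest
  of \<open>W\<close> lies in \<open>U\<close>. In the application \<open>W\<close> is the set of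
  free variables of the quantified subformula and \<open>U\<close> that of the whole
  formula.\<close>

lemma team_restrict_supplement_eq:
  assumes eq: "team_restrict X U = team_restrict Y U"
    and W: "W - {v} \<subseteq> U"
    and FG: "\<forall>s \<in> asgs X. \<forall>t \<in> asgs Y. s |` U = t |` U \<longrightarrow> F s = G t"
  shows "team_restrict (supplement X F v) W = team_restrict (supplement Y G v) W"
proof -
  have upd: "(s(v \<mapsto> a)) |` W = (t(v \<mapsto> a)) |` W" if "s |` U = t |` U"
    for s t :: "('a, 'b) asg" and a
    using that W unfolding restrict_map_eq_iff by auto
  show ?thesis
  proof (rule team_restrict_eqI)
    show "tdom (supplement X F v) \<inter> W = tdom (supplement Y G v) \<inter> W"
      using eq W by (auto simp: team_restrict_def)
  next
    fix r assume "r \<in> asgs (supplement X F v)"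
    then obtain s a where r: "r = s(v \<mapsto> a)" and s: "s \<in> asgs X" "a \<in> F s"
      by (auto simp: asgs_supplement)
    obtain t where t: "t \<in> asgs Y" "t |` U = s |` U"
      using team_restrict_eqD[OF eq s(1)] .
    have "a \<in> G t" using s t FG by simp
    then have "t(v \<mapsto> a) \<in> asgs (supplement Y G v)"
      using t by (auto simp: asgs_supplement)
    then show "\<exists>q \<in> asgs (supplement Y G v). q |` W = r |` W"
      using upd[OF t(2)] r by blast
  next
    fix r assume "r \<in> asgs (supplement Y G v)"
    then obtain t a where r: "r = t(v \<mapsto> a)" and t: "t \<in> asgs Y" "a \<in> G t"
      by (auto simp: asgs_supplement)
    obtain s where s: "s \<in> asgs X" "s |` U = t |` U"
      using team_restrict_eqD[OF eq[symmetric] t(1)] .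
    have "a \<in> F s" using s t FG by simp
    then have "s(v \<mapsto> a) \<in> asgs (supplement X F v)"
      using s by (auto simp: asgs_supplement)
    then show "\<exists>q \<in> asgs (supplement X F v). q |` W = r |` W"
      using upd[OF s(2)] r by blast
  qed
qed

text \<open>\<open>G\<close> evaluates \<open>F\<close> at a chosen partner in \<open>X\<close>. All
  its values are values of \<open>F\<close>, so an arbitrary value set \<open>B\<close> is allowed:
  nonempty subsets for the existential quantifier, a local quantifier without any closure property
  otherwise.\<close>

lemma uniform_choice_transfer:
  assumes eq: "team_restrict X U = team_restrict Y U"
    and domX: "\<forall>s \<in> asgs X. dom s = tdom X" and domY: "\<forall>s \<in> asgs Y. dom s = tdom Y"
    and V: "V \<subseteq> U" and UX: "U \<subseteq> tdom X"
    and F: "F \<in> asgs X \<rightarrow> B" and unif: "uniform (tdom X - V) X F"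
  obtains G where "G \<in> asgs Y \<rightarrow> B" and "uniform (tdom Y - V) Y G"
    and "\<forall>s \<in> asgs X. \<forall>t \<in> asgs Y. s |` U = t |` U \<longrightarrow> F s = G t"
proof -
  \<comment> \<open>The fact named \<open>FV\<close> says that \<open>F\<close> depends only on the
    values on \<open>V\<close>; it is not the free-variable function.\<close>
  have FV: "F s = F s'" if "s \<in> asgs X" "s' \<in> asgs X" "\<forall>x \<in> V. s x = s' x" for s s'
    using unif that unfolding uniform_slashed_iff[OF domX subset_trans[OF V UX]] restrict_map_eq_iff
    by blast
  define c where "c t = (SOME s. s \<in> asgs X \<and> s |` U = t |` U)" for t
  have c: "c t \<in> asgs X \<and> c t |` U = t |` U" if t: "t \<in> asgs Y" for t
  proof -
    obtain s where "s \<in> asgs X \<and> s |` U = t |` U"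
      using team_restrict_eqD[OF eq[symmetric] t] by blast
    then show ?thesis unfolding c_def by (rule someI[of "\<lambda>s. s \<in> asgs X \<and> s |` U = t |` U"])
  qed
  have cV: "c t x = t x" if "t \<in> asgs Y" "x \<in> V" for t x
    using c[OF that(1)] that(2) V by (auto simp: restrict_map_eq_iff)
  have 1: "F \<circ> c \<in> asgs Y \<rightarrow> B"
    using F c by auto
  have VY: "V \<subseteq> tdom Y"
    using team_restrict_eq_tdom[OF eq UX] V by blast
  have 2: "uniform (tdom Y - V) Y (F \<circ> c)"
    unfolding uniform_slashed_iff[OF domY VY] restrict_map_eq_iff comp_apply
    by (intro ballI impI FV) (simp_all add: c cV)
  \<comment> \<open>Both \<open>s\<close> and \<open>c t\<close> agree with \<open>t\<close> on
    \<open>V \<subseteq> U\<close>, so \<open>F\<close> does not notice which partner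
    \<open>c\<close> has picked.\<close>
  have 3: "\<forall>s \<in> asgs X. \<forall>t \<in> asgs Y. s |` U = t |` U \<longrightarrow> F s = (F \<circ> c) t"
    unfolding restrict_map_eq_iff comp_apply
    by (intro ballI impI FV) (use V in \<open>auto simp: c cV\<close>)
  show ?thesis using that[OF 1 2 3] .
qed

text \<open>A part \<open>Z\<close> of \<open>X\<close> is carried over to the set of all
  assignments of \<open>Y\<close> that have a partner in \<open>Z\<close>. No element of
  \<open>Z\<close> is lost, since each has some partner in \<open>Y\<close>.\<close>

lemma team_split_transfer:
  assumes eq: "team_restrict X U = team_restrict Y U" and Z: "Z \<subseteq> asgs X"
  shows "team_restrict \<lparr>tdom = tdom X, asgs = Z\<rparr> U =
    team_restrict \<lparr>tdom = tdom Y, asgs = {t \<in> asgs Y. t |` U \<in> (\<lambda>s. s |` U) ` Z}\<rparr> U"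
proof (rule team_restrict_eqI, goal_cases)
  case 1
  then show ?case using eq by (simp add: team_restrict_def)
next
  case (2 s)
  then have "s \<in> asgs X" using Z by auto
  then obtain t where "t \<in> asgs Y" "t |` U = s |` U"
    using team_restrict_eqD[OF eq] by blast
  then show ?case using 2 by auto
next
  case (3 t)
  then show ?case by auto
qed

text \<open>Two arbitrary teams are compared because restrictions to free variables are not
  preserved by the recursion: the domain reached at a subformula may exceed its free variables, for
  instance by variables of a slashed set.\<close>

lemma sat_transfer:
  assumes "team_restrict X (FV \<phi>) = team_restrict Y (FV \<phi>)"
    and "\<forall>s \<in> asgs X. dom s = tdom X" and "\<forall>s \<in> asgs Y. dom s = tdom Y"
    and "FV \<phi> \<subseteq> tdom X" and "sat M X \<phi>"
  shows "sat M Y \<phi>"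
  using assms
proof (induction \<phi> arbitrary: X Y)
  case (Atom \<alpha>)
  show ?case
    unfolding sat.simps
  proof
    fix t assume "t \<in> asgs Y"
    then obtain s where "s \<in> asgs X" "s |` vars_atom \<alpha> = t |` vars_atom \<alpha>"
      using team_restrict_eqD[OF Atom.prems(1)[symmetric]] by auto
    then show "sat_atom M t \<alpha>"
      using Atom.prems(5) sat_atom_cong[of s "vars_atom \<alpha>" t \<alpha> M] by simp
  qed
next
  case (NegAtom \<alpha>)
  show ?case
    unfolding sat.simps
  proof
    fix t assume "t \<in> asgs Y"
    then obtain s where "s \<in> asgs X" "s |` vars_atom \<alpha> = t |` vars_atom \<alpha>"
      using team_restrict_eqD[OF NegAtom.prems(1)[symmetric]] by auto
    then show "\<not> sat_atom M t \<alpha>"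
      using NegAtom.prems(5) sat_atom_cong[of s "vars_atom \<alpha>" t \<alpha> M] by simp
  qed
next
  case (Conj \<psi> \<chi>)
  have "team_restrict X (FV \<psi>) = team_restrict Y (FV \<psi>)"
    "team_restrict X (FV \<chi>) = team_restrict Y (FV \<chi>)"
    using team_restrict_eq_mono[OF Conj.prems(1)] by simp_all
  then show ?case
    using Conj.IH(1)[of X Y] Conj.IH(2)[of X Y] Conj.prems(2-5) by simp
next
  case (Disj \<psi> \<chi>)
  let ?U = "FV \<psi> \<union> FV \<chi>"
  have eq: "team_restrict X ?U = team_restrict Y ?U"
    using Disj.prems(1) by simp
  obtain X1 X2 where X: "asgs X = X1 \<union> X2"
    and sat: "sat M \<lparr>tdom = tdom X, asgs = X1\<rparr> \<psi>" "sat M \<lparr>tdom = tdom X, asgs = X2\<rparr> \<chi>"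
    using Disj.prems(5) by auto
  \<comment> \<open>Membership is decided by the values on the free variables of both disjuncts, so
    that one correspondence serves \<open>X1\<close> and \<open>X2\<close>.\<close>
  define lift where "lift Z = {t \<in> asgs Y. t |` ?U \<in> (\<lambda>s. s |` ?U) ` Z}" for Z
  have lift: "team_restrict \<lparr>tdom = tdom X, asgs = Z\<rparr> ?U =
      team_restrict \<lparr>tdom = tdom Y, asgs = lift Z\<rparr> ?U" if "Z \<subseteq> asgs X" for Z
    unfolding lift_def using team_split_transfer[OF eq that] .
  have liftY: "lift Z \<subseteq> asgs Y" for Z
    by (auto simp: lift_def)
  have dom_lift: "\<forall>s \<in> lift Z. dom s = tdom Y" for Z
    using Disj.prems(3) by (simp add: lift_def)
  have "sat M \<lparr>tdom = tdom Y, asgs = lift X1\<rparr> \<psi>"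
  proof (rule Disj.IH(1)[OF _ _ _ _ sat(1)])
    show "team_restrict \<lparr>tdom = tdom X, asgs = X1\<rparr> (FV \<psi>) =
        team_restrict \<lparr>tdom = tdom Y, asgs = lift X1\<rparr> (FV \<psi>)"
      by (rule team_restrict_eq_mono[OF lift]) (simp_all add: X)
  qed (use Disj.prems(2,4) X dom_lift in simp_all)
  moreover have "sat M \<lparr>tdom = tdom Y, asgs = lift X2\<rparr> \<chi>"
  proof (rule Disj.IH(2)[OF _ _ _ _ sat(2)])
    show "team_restrict \<lparr>tdom = tdom X, asgs = X2\<rparr> (FV \<chi>) =
        team_restrict \<lparr>tdom = tdom Y, asgs = lift X2\<rparr> (FV \<chi>)"
      by (rule team_restrict_eq_mono[OF lift]) (simp_all add: X)
  qed (use Disj.prems(2,4) X dom_lift in simp_all)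
  \<comment> \<open>Each \<open>t\<close> has a partner in \<open>X\<close>, and that partner lies
    in \<open>X1\<close> or \<open>X2\<close>. The two lifts may overlap, which a splitting
    permits.\<close>
  moreover have "asgs Y = lift X1 \<union> lift X2"
  proof
    show "asgs Y \<subseteq> lift X1 \<union> lift X2"
    proof
      fix t assume t: "t \<in> asgs Y"
      then obtain s where "s \<in> X1 \<union> X2" "s |` ?U = t |` ?U"
        using team_restrict_eqD[OF eq[symmetric]] X by metis
      then show "t \<in> lift X1 \<union> lift X2"
        using t unfolding lift_def by (auto simp: image_iff dest: sym)
    qed
  qed (use liftY in auto)
  ultimately show ?case by auto
next
  case (Exists v V \<psi>)
  obtain F where F: "F \<in> asgs X \<rightarrow> Pow (univ M) - {{}}" "uniform (tdom X - V) X F"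
    and sat: "sat M (supplement X F v) \<psi>"
    using Exists.prems(5) by auto
  have V: "V \<subseteq> FV (Exists v V \<psi>)" by simp
  obtain G where G: "G \<in> asgs Y \<rightarrow> Pow (univ M) - {{}}" "uniform (tdom Y - V) Y G"
    and FG: "\<forall>s \<in> asgs X. \<forall>t \<in> asgs Y.
      s |` FV (Exists v V \<psi>) = t |` FV (Exists v V \<psi>) \<longrightarrow> F s = G t"
    using uniform_choice_transfer[OF Exists.prems(1-3) V Exists.prems(4) F] .
  have "sat M (supplement Y G v) \<psi>"
    by (rule Exists.IH[OF team_restrict_supplement_eq[OF Exists.prems(1) _ FG]
          dom_supplement[OF Exists.prems(2)] dom_supplement[OF Exists.prems(3)] _ sat])
      (use Exists.prems(4) in auto)
  then show ?case using G by auto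
next
  case (Forall v V \<psi>)
  have sat: "sat M (supplement X (\<lambda>_. univ M) v) \<psi>"
    using Forall.prems(5) by (simp add: duplicate_eq_supplement)
  \<comment> \<open>Both choice functions are constantly \<open>univ M\<close>, so their agreement
    on partners is immediate.\<close>
  have "sat M (supplement Y (\<lambda>_. univ M) v) \<psi>"
    by (rule Forall.IH[OF team_restrict_supplement_eq[OF Forall.prems(1)]
          dom_supplement[OF Forall.prems(2)] dom_supplement[OF Forall.prems(3)] _ sat])
      (use Forall.prems(4) in auto)
  then show ?case by (simp add: duplicate_eq_supplement)
next
  case (Quant Q v V \<psi>)
  obtain F where F: "F \<in> asgs X \<rightarrow> local_quantifier Q (univ M)" "uniform (tdom X - V) X F"
    and sat: "sat M (supplement X F v) \<psi>"
    using Quant.prems(5) by auto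
  have V: "V \<subseteq> FV (Quant Q v V \<psi>)" by simp
  \<comment> \<open>The sets chosen by \<open>F\<close> are reused unchanged, neither enlarged nor
    shrunk, so they stay in the local quantifier without monotonicity.\<close>
  obtain G where G: "G \<in> asgs Y \<rightarrow> local_quantifier Q (univ M)" "uniform (tdom Y - V) Y G"
    and FG: "\<forall>s \<in> asgs X. \<forall>t \<in> asgs Y.
      s |` FV (Quant Q v V \<psi>) = t |` FV (Quant Q v V \<psi>) \<longrightarrow> F s = G t"
    using uniform_choice_transfer[OF Quant.prems(1-3) V Quant.prems(4) F] .
  have "sat M (supplement Y G v) \<psi>"
    by (rule Quant.IH[OF team_restrict_supplement_eq[OF Quant.prems(1) _ FG]
          dom_supplement[OF Quant.prems(2)] dom_supplement[OF Quant.prems(3)] _ sat])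
      (use Quant.prems(4) in auto)
  then show ?case using G by auto
qed

theorem mainTheorem3:
  fixes L :: "('f, 'r) vocab"
    and M :: "('f, 'r, 'm) struct"
    and \<Q> :: "'m quantifier set"
    and \<phi> :: "('f, 'r, 'v, 'm) fm"
    and X :: "('v, 'm) team"
  assumes "is_structure L M"
    and "\<forall>Q \<in> \<Q>. generalized_quantifier Q"
    and "\<phi> \<in> DF L \<Q>"
    and "is_team (univ M) X"
    and "suitable X \<phi>"
  shows "sat M X \<phi> \<longleftrightarrow> sat M (team_restrict X (FV \<phi>)) \<phi>"
proof -
  let ?Y = "team_restrict X (FV \<phi>)"
  \<comment> \<open>Restriction to a fixed set is idempotent.\<close>
  have eq: "team_restrict X (FV \<phi>) = team_restrict ?Y (FV \<phi>)"
    by (simp add: team_restrict_def image_image)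
  have domX: "\<forall>s \<in> asgs X. dom s = tdom X"
    using assms(4) by (simp add: is_team_def)
  then have domY: "\<forall>s \<in> asgs ?Y. dom s = tdom ?Y"
    by (auto simp: team_restrict_def)
  have X: "FV \<phi> \<subseteq> tdom X"
    using assms(5) by (simp add: suitable_def)
  show ?thesis
    using sat_transfer[OF eq domX domY X]
      \<comment> \<open>For the converse the teams swap roles, and suitability of \<open>?Y\<close>
        is inherited from \<open>X\<close> along \<open>eq\<close>.\<close>
      sat_transfer[OF eq[symmetric] domY domX team_restrict_eq_tdom[OF eq X]] by blast
qed

end
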